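(* Let $m\in\mathcal{P}(X)$. Assume that $g$ is bounded, that $f$ is convex and differentiable with Lipschitz continuous gradient, and that for every $\lambda\in\mathcal{H}_f:=\nabla f(\mathcal{H})$ the function $g_\lambda$ is lower semi-continuous on $Z$, the set-valued map $G_\lambda$ is lower semi-continuous, and $\mathrm{BR}_\lambda(x)\neq\emptyset$ for all $x\in X$. Let $(\mu_n)_{n\ge1}$ be a minimizing sequence for the problem $$\inf_{\mu\in\mathcal{P}_m(Z)} f\left(\int_Z g\,d\mu\right),$$ and suppose that $\{\mu_n\}_{n\ge1}$ is tight in $\mathcal{P}(Z)$, i.e. for any $\epsilon>0$ there is a compact set $K_\epsilon\subseteq Z$ such that $\mu_n(K_\epsilon)\ge1-\epsilon$ for all $n\ge1$. Then $\{\mu_n\}_{n\ge1}$ has at least one accumulation point for the narrow topology, and every such accumulation point is a solution of the problem.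
   Context: $X$ and $Y$ are complete separable metric spaces with their Borel $\sigma$-algebras; $\mathcal{P}(\cdot)$ denotes the set of Borel probability measures. $F\colon X\rightsquigarrow Y$ is a set-valued map with non-empty values and closed graph; $Z_x:=F(x)$ and $Z:=\{(x,y)\in X\times Y: y\in Z_x\}$. $\mathcal{H}$ is a separable real Hilbert space; $g\colon Z\to\mathcal{H}$ and $f\colon\mathcal{H}\to\mathbb{R}$ are Borel measurable. With $\pi_1(x,y)=x$, $\mathcal{P}_m(Z)=\{\mu\in\mathcal{P}(Z):\pi_1\#\mu=m\}$. Integrals of $g$ are Bochner integrals. A solution is a minimizer. For $\lambda\in\mathcal{H}$: $g_\lambda(x,y)=\langle\lambda,g(x,y)\rangle$ on $Z$; $G_\lambda\colon X\rightsquigarrow\mathbb{R}$, $G_\lambda(x)=\{g_\lambda(x,y):y\in Z_x\}$; $\mathrm{BR}_\lambda(x)=\operatorname{argmin}_{y\in Z_x}g_\lambda(x,y)$. A set-valued map $\Phi$ with non-empty values is lower semi-continuous if for every $x$, every $y\in\Phi(x)$ and every sequence $x_n\to x$ there exist $y_n\in\Phi(x_n)$ with $y_n\to y$. Narrow convergence $\mu_n\to\mu$ in $\mathcal{P}(Z)$ means $\int h\,d\mu_n\to\int h\,d\mu$ for all bounded continuous $h\colon Z\to\mathbb{R}$. *)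

theory Defs
  imports "HOL-Probability.Probability"
begin

text \<open>Borel probability measures on a subset \<open>S\<close> of a topological space, with the subspace Borel
  sigma-algebra. Such a measure has \<open>space \<mu> = S\<close>, so integrals over it only see values on \<open>S\<close>.\<close>

definition borel_probs :: "'a::topological_space set \<Rightarrow> 'a measure set" where
  "borel_probs S = {\<mu>. prob_space \<mu> \<and> sets \<mu> = sets (restrict_space borel S)}"

text \<open>The narrow topology: the coarsest one making \<open>\<mu> \<mapsto> \<integral> h d\<mu>\<close> continuous for every bounded
  continuous \<open>h : S \<rightarrow> \<real>\<close>.\<close>

definition narrow_topology :: "'a::topological_space set \<Rightarrow> 'a measure topology" where
  "narrow_topology S = topology_generated_by
     {{\<mu> \<in> borel_probs S. integral\<^sup>L \<mu> h \<in> U} | h U.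
        continuous_on S h \<and> bounded (h ` S) \<and> open (U :: real set)}"

lemma topspace_narrow_topology [simp]: "topspace (narrow_topology S) = borel_probs S"
proof -
  have "continuous_on S (\<lambda>_. 0::real)" "bounded ((\<lambda>_. 0::real) ` S)" "open (UNIV::real set)"
    by (auto intro!: boundedI[where B=0])
  then have "{\<mu> \<in> borel_probs S. integral\<^sup>L \<mu> (\<lambda>_. 0::real) \<in> UNIV} \<subseteq> topspace (narrow_topology S)"
    unfolding narrow_topology_def topology_generated_by_topspace by blast
  then show ?thesis
    by (auto simp: narrow_topology_def)
qed

lemma openin_narrow_topology_subbasis:
  assumes "continuous_on S h" "bounded (h ` S)" "open (U :: real set)"
  shows "openin (narrow_topology S) {\<mu> \<in> borel_probs S. integral\<^sup>L \<mu> h \<in> U}"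
  unfolding narrow_topology_def using assms by (intro topology_generated_by_Basis) blast

lemma limitin_narrow_topology_iff:
  assumes "\<And>n. \<mu> n \<in> borel_probs S" and "\<nu> \<in> borel_probs S"
  shows "limitin (narrow_topology S) \<mu> \<nu> sequentially \<longleftrightarrow>
    (\<forall>h :: 'a::topological_space \<Rightarrow> real. continuous_on S h \<and> bounded (h ` S) \<longrightarrow>
       (\<lambda>n. integral\<^sup>L (\<mu> n) h) \<longlonglongrightarrow> integral\<^sup>L \<nu> h)"  (is "?L \<longleftrightarrow> ?R")
proof
  assume L: ?L
  show ?R
  proof (intro allI impI topological_tendstoI)
    fix h :: "'a \<Rightarrow> real" and U :: "real set"
    assume h: "continuous_on S h \<and> bounded (h ` S)" and U: "open U" "integral\<^sup>L \<nu> h \<in> U"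
    have "openin (narrow_topology S) {\<mu> \<in> borel_probs S. integral\<^sup>L \<mu> h \<in> U}"
      using h U by (intro openin_narrow_topology_subbasis) auto
    then have "\<forall>\<^sub>F n in sequentially. \<mu> n \<in> {\<mu> \<in> borel_probs S. integral\<^sup>L \<mu> h \<in> U}"
      using L U assms(2) unfolding limitin_def by blast
    then show "\<forall>\<^sub>F n in sequentially. integral\<^sup>L (\<mu> n) h \<in> U"
      by (rule eventually_mono) simp
  qed
next
  assume R: ?R
  have *: "\<nu> \<in> W \<longrightarrow> (\<forall>\<^sub>F n in sequentially. \<mu> n \<in> W)" if "openin (narrow_topology S) W" for W
  proof -
    have "generate_topology_on {{\<mu> \<in> borel_probs S. integral\<^sup>L \<mu> h \<in> U} | h U.
        continuous_on S h \<and> bounded (h ` S) \<and> open (U :: real set)} W"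
      using that by (simp add: narrow_topology_def openin_topology_generated_by_iff)
    then show ?thesis
    proof induction
      case (Int a b)
      then show ?case by (auto intro: eventually_conj)
    next
      case (UN K)
      then show ?case by (blast intro: eventually_mono)
    next
      case (Basis s)
      then obtain h and U :: "real set" where s: "s = {\<mu> \<in> borel_probs S. integral\<^sup>L \<mu> h \<in> U}"
        and h: "continuous_on S h" "bounded (h ` S)" and U: "open U" by blast
      show ?case
        using R h U assms(1) by (auto simp: s dest: topological_tendstoD)
    qed simp
  qed
  then show ?L
    using assms(2) by (auto simp: limitin_def)
qed

text \<open>Accumulation points of the sequence \<open>x\<close> (not of its range): every neighbourhood contains
  \<open>x n\<close> for infinitely many \<open>n\<close>, so a constant sequence accumulates at its value.\<close>

definition accumulation_point :: "'a topology \<Rightarrow> (nat \<Rightarrow> 'a) \<Rightarrow> 'a \<Rightarrow> bool" where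
  "accumulation_point T x a \<longleftrightarrow>
     a \<in> topspace T \<and> (\<forall>U. openin T U \<and> a \<in> U \<longrightarrow> (\<exists>\<^sub>F n in sequentially. x n \<in> U))"

lemma accumulation_point_subseq:
  assumes "strict_mono r" "limitin T (x \<circ> r) a sequentially"
  shows "accumulation_point T x a"
  unfolding accumulation_point_def
proof (intro conjI allI impI)
  show "a \<in> topspace T"
    using assms(2) by (simp add: limitin_def)
  fix U assume U: "openin T U \<and> a \<in> U"
  then obtain N where N: "x (r n) \<in> U" if "n \<ge> N" for n
    using assms(2) by (auto simp: limitin_def eventually_sequentially)
  have "\<exists>n\<ge>m. x n \<in> U" for m
    using N[of "max N m"] seq_suble[OF assms(1), of "max N m"]
    by (intro exI[of _ "r (max N m)"]) auto
  then show "\<exists>\<^sub>F n in sequentially. x n \<in> U"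
    by (auto simp: frequently_sequentially)
qed

definition tight_seq :: "'a::topological_space set \<Rightarrow> (nat \<Rightarrow> 'a measure) \<Rightarrow> bool" where
  "tight_seq S \<mu> \<longleftrightarrow>
     (\<forall>\<epsilon>>0. \<exists>K. compact K \<and> K \<subseteq> S \<and> (\<forall>n. measure (\<mu> n) K \<ge> 1 - \<epsilon>))"

definition lsc_on :: "'a::topological_space set \<Rightarrow> ('a \<Rightarrow> real) \<Rightarrow> bool" where
  "lsc_on S \<phi> \<longleftrightarrow> (\<forall>x\<in>S. \<forall>c<\<phi> x. \<forall>\<^sub>F y in at x within S. c < \<phi> y)"

definition lsc_setmap :: "('a::topological_space \<Rightarrow> 'b::topological_space set) \<Rightarrow> bool" where
  "lsc_setmap \<Phi> \<longleftrightarrow>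
     (\<forall>x. \<forall>y\<in>\<Phi> x. \<forall>xs. xs \<longlonglongrightarrow> x \<longrightarrow>
        (\<exists>ys. (\<forall>n. ys n \<in> \<Phi> (xs n)) \<and> ys \<longlonglongrightarrow> y))"

definition gradient :: "('h::real_inner \<Rightarrow> real) \<Rightarrow> 'h \<Rightarrow> 'h" where
  "gradient f x = (THE D. GDERIV f x :> D)"

lemma gradient_eqI:
  assumes "GDERIV f x :> D"
  shows "gradient f x = D"
  unfolding gradient_def
proof (rule the_equality)
  fix E assume "GDERIV f x :> E"
  then have "(\<lambda>h. inner h E) = (\<lambda>h. inner h D)"
    using assms unfolding gderiv_def by (rule has_derivative_unique)
  then have "inner (E - D) E = inner (E - D) D" by metis
  then show "E = D"
    by (metis inner_diff_right inner_eq_zero_iff right_minus_eq)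
qed fact

abbreviation graph :: "('a \<Rightarrow> 'b set) \<Rightarrow> ('a \<times> 'b) set" where
  "graph F \<equiv> Sigma UNIV F"

definition best_response ::
  "('a \<Rightarrow> 'b set) \<Rightarrow> ('a \<times> 'b \<Rightarrow> 'h::real_inner) \<Rightarrow> 'h \<Rightarrow> 'a \<Rightarrow> 'b set" where
  "best_response F g l x = {y. is_arg_min (\<lambda>y. inner l (g (x, y))) (\<lambda>y. y \<in> F x) y}"

definition probs_with_marginal ::
  "'a::topological_space measure \<Rightarrow> ('a \<times> 'b::topological_space) set \<Rightarrow> ('a \<times> 'b) measure set" where
  "probs_with_marginal m Z = {\<mu> \<in> borel_probs Z. distr \<mu> borel fst = m}"

text \<open>The infimum is taken in the extended reals, so no convention for unbounded sets of reals
  is involved.\<close>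

definition minimizing_sequence :: "('a \<Rightarrow> real) \<Rightarrow> 'a set \<Rightarrow> (nat \<Rightarrow> 'a) \<Rightarrow> bool" where
  "minimizing_sequence J A x \<longleftrightarrow>
     (\<forall>n. x n \<in> A) \<and> (\<lambda>n. ereal (J (x n))) \<longlonglongrightarrow> (INF a\<in>A. ereal (J a))"

end

theory Submission
  imports Defs
begin

text \<open>
  The convexity inequality \<open>f(v) \<ge> f(v\<^sup>*) + \<langle>\<nabla>f(v\<^sup>*), v - v\<^sup>*\<rangle>\<close>, together with the lower
  semicontinuity of \<open>\<langle>\<nabla>f(v\<^sup>*), g\<rangle>\<close>, makes \<open>\<mu> \<mapsto> f(\<integral>g d\<mu>)\<close> narrowly lower semicontinuous.
  Existence of accumulation points is Prokhorov's theorem: the measures are carried by a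
  \<open>\<sigma>\<close>-compact set, which a ternary code maps injectively into the real line with an inverse that
  extends continuously to a closed set, and there Helly's selection theorem applies.
\<close>

section \<open>Gradients in Hilbert space\<close>

text \<open>The means \<open>integral\<^sup>L (\<mu> n) g\<close> need not converge when
  \<open>g\<close> is discontinuous. The objective is therefore compared with its tangent at the
  mean of \<open>\<nu>\<close>, so that a single scalar function, \<open>inner l (g z)\<close> with
  \<open>l = gradient f (integral\<^sup>L \<nu> g)\<close>, has to survive the limit. An
  accumulation point is not exchanged for the limit of a subsequence; it is used through statements
  that hold for infinitely many \<open>n\<close>, one test function at a time. For compactness, the
  obstacle is that a code built from countably many open sets is Borel but in general discontinuous,
  so continuity is available only for its inverse. Base 3 with digits 0 and 1 leaves gaps, so close
  codes share their initial digits; in base 2 the expansions 0111... and 1000... would collide.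
  Finitely many digits control distances only uniformly on compact sets, which is why the compact
  sets given by tightness are coded in disjoint intervals and glued afterwards.\<close>

lemma bounded_linear_eq_inner:
  fixes \<phi> :: "'h::{real_inner,complete_space} \<Rightarrow> real"
  assumes "bounded_linear \<phi>"
  obtains D where "\<phi> = (\<lambda>h. inner h D)"
proof -
  interpret bounded_linear \<phi> by fact
  \<comment> \<open>The representing vector is the minimizer of \<open>J\<close>.\<close>
  define J where "J x = (norm x)\<^sup>2 / 2 - \<phi> x" for x
  obtain K where K: "\<And>x. norm (\<phi> x) \<le> norm x * K"
    using bounded by blast
  have "- K\<^sup>2 / 2 \<le> J x" for x
  proof -
    have "0 \<le> (norm x - K)\<^sup>2" by simp
    then show ?thesis
      using K[of x] by (simp add: J_def power2_diff)
  qed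
  then have bdd: "bdd_below (range J)" by (auto simp: bdd_below_def)
  define I where "I = Inf (range J)"
  have I_le: "I \<le> J x" for x
    unfolding I_def using bdd by (intro cInf_lower) auto
  have "\<exists>x. J x < I + 1 / Suc n" for n
    using cInf_lessD[of "range J" "I + 1 / Suc n"] by (auto simp: I_def)
  then obtain x where x: "\<And>n. J (x n) < I + 1 / Suc n" by metis
  \<comment> \<open>The linear part \<open>\<phi>\<close> cancels, so near-minimizers of
    \<open>J\<close> are close to each other: this makes the minimizing sequence Cauchy.\<close>
  have parallelogram: "(norm (a - b))\<^sup>2 / 4 = J a + J b - 2 * J ((1/2) *\<^sub>R (a + b))" for a b
    by (simp add: J_def power2_norm_eq_inner inner_add inner_diff scaleR add inner_commute field_simps)
  have "Cauchy x"
  proof (rule metric_CauchyI)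
    fix e :: real assume "e > 0"
    \<comment> \<open>Two points within \<open>1 / Suc N\<close> of the infimum have squared
      distance below \<open>4 * (2 / Suc N)\<close>.\<close>
    then obtain N where N: "8 / Suc N < e\<^sup>2"
      using reals_Archimedean[of "e\<^sup>2 / 8"] by (auto simp: field_simps)
    have "dist (x i) (x j) < e" if "i \<ge> N" "j \<ge> N" for i j
    proof -
      have "1 / Suc i \<le> 1 / Suc N" "1 / Suc j \<le> 1 / Suc N"
        using that by (auto simp: field_simps)
      then have "(norm (x i - x j))\<^sup>2 < e\<^sup>2"
        using parallelogram[of "x i" "x j"] x[of i] x[of j] I_le[of "(1/2) *\<^sub>R (x i + x j)"] N by simp
      then show ?thesis
        using \<open>e > 0\<close> by (simp add: dist_norm power_less_imp_less_base)
    qed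
    then show "\<exists>N. \<forall>i\<ge>N. \<forall>j\<ge>N. dist (x i) (x j) < e" by blast
  qed
  then obtain D where D: "x \<longlonglongrightarrow> D"
    using Cauchy_convergent_iff convergent_def by blast
  have "(\<lambda>n. J (x n)) \<longlonglongrightarrow> J D"
    unfolding J_def by (intro tendsto_intros D tendsto) simp
  moreover have "(\<lambda>n. I + 1 / Suc n) \<longlonglongrightarrow> I + 0"
    by (intro tendsto_intros LIMSEQ_inverse_real_of_nat[unfolded inverse_eq_divide])
  ultimately have "J D \<le> I"
    using x by (intro LIMSEQ_le[of "\<lambda>n. J (x n)" _ "\<lambda>n. I + 1 / Suc n"]) (auto intro: less_imp_le)
  then have min: "J D \<le> J y" for y
    using I_le[of y] by simp
  \<comment> \<open>The first-order condition at the minimizer \<open>D\<close> is exactly the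
    representation sought.\<close>
  have "((\<lambda>x. J x) has_derivative (\<lambda>h. inner h D - \<phi> h)) (at D)"
    unfolding J_def power2_norm_eq_inner
    by (auto intro!: derivative_eq_intros has_derivative simp: inner_commute)
  then have "(\<lambda>h. inner h D - \<phi> h) = (\<lambda>h. 0)"
    using min by (intro has_derivative_local_min[of J]) auto
  then have "\<phi> = (\<lambda>h. inner h D)"
    by (metis eq_iff_diff_eq_0)
  then show ?thesis by (rule that)
qed

text \<open>As \<open>gradient\<close> is a definite description, it means something only once a
  gradient vector exists. Riesz representation of the Frechet derivative supplies one.\<close>

lemma GDERIV_gradient:
  fixes f :: "'h::{real_inner,complete_space} \<Rightarrow> real"
  assumes "f differentiable (at x)"
  shows "GDERIV f x :> gradient f x"
proof -
  obtain f' where f': "(f has_derivative f') (at x)"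
    using assms by (auto simp: differentiable_def)
  then obtain D where "f' = (\<lambda>h. inner h D)"
    using bounded_linear_eq_inner has_derivative_bounded_linear by blast
  with f' have "GDERIV f x :> D"
    by (simp add: gderiv_def)
  then show ?thesis
    using gradient_eqI by metis
qed

text \<open>Restriction to the line through \<open>x\<close> and \<open>y\<close> reduces this to
  the tangent inequality for convex functions of one real variable.\<close>

lemma convex_on_above_tangent_gderiv:
  fixes f :: "'h::real_inner \<Rightarrow> real"
  assumes f: "convex_on UNIV f" and D: "GDERIV f x :> D"
  shows "f x + inner D (y - x) \<le> f y"
proof -
  define k where "k t = f (x + t *\<^sub>R (y - x))" for t
  have "convex_on UNIV k"
  proof (rule convex_onI)
    fix t a b :: real assume t: "0 < t" "t < 1"
    have "x + ((1 - t) *\<^sub>R a + t *\<^sub>R b) *\<^sub>R (y - x)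
        = (1 - t) *\<^sub>R (x + a *\<^sub>R (y - x)) + t *\<^sub>R (x + b *\<^sub>R (y - x))"
      by (simp add: algebra_simps)
    then show "k ((1 - t) *\<^sub>R a + t *\<^sub>R b) \<le> (1 - t) * k a + t * k b"
      using convex_onD[OF f, of t] t by (simp add: k_def)
  qed simp
  moreover have "(k has_field_derivative inner D (y - x)) (at 0)"
  proof -
    have "(f has_derivative (\<lambda>h. inner h D)) (at (x + 0 *\<^sub>R (y - x)))"
      using D by (simp add: gderiv_def)
    moreover have "((\<lambda>t. x + t *\<^sub>R (y - x)) has_derivative (\<lambda>t. t *\<^sub>R (y - x))) (at 0)"
      by (auto intro!: derivative_eq_intros)
    ultimately have "(k has_derivative (\<lambda>t. inner (t *\<^sub>R (y - x)) D)) (at 0)"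
      unfolding k_def by (rule has_derivative_compose[rotated])
    then show ?thesis
      by (simp add: has_field_derivative_def inner_commute mult.commute[of _ "inner D (y - x)"])
  qed
  ultimately have "k 1 - k 0 \<ge> inner D (y - x) * (1 - 0)"
    by (intro convex_on_imp_above_tangent[of UNIV]) auto
  then show ?thesis by (simp add: k_def)
qed

section \<open>Narrow limits and lower semicontinuous integrands\<close>

lemma borel_probs_imp_space: "\<mu> \<in> borel_probs S \<Longrightarrow> space \<mu> = S"
  using sets_eq_imp_space_eq[of \<mu> "restrict_space borel S"]
  by (simp add: borel_probs_def space_restrict_space)

lemma borel_probs_imp_prob_space: "\<mu> \<in> borel_probs S \<Longrightarrow> prob_space \<mu>"
  by (simp add: borel_probs_def)

lemma borel_probs_imp_measurable_eq:
  "\<mu> \<in> borel_probs S \<Longrightarrow> measurable \<mu> M = measurable (restrict_space borel S) M"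
  by (intro measurable_cong_sets) (auto simp: borel_probs_def)

lemma integrable_borel_probs_bounded:
  fixes h :: "'a::topological_space \<Rightarrow> 'h::{banach, second_countable_topology}"
  assumes "\<mu> \<in> borel_probs S" "h \<in> borel_measurable (restrict_space borel S)" "bounded (h ` S)"
  shows "integrable \<mu> h"
proof -
  interpret prob_space \<mu> using assms(1) by (rule borel_probs_imp_prob_space)
  obtain B where "\<And>x. x \<in> S \<Longrightarrow> norm (h x) \<le> B"
    using assms(3) by (auto simp: bounded_iff)
  then have "AE x in \<mu>. norm (h x) \<le> B"
    using assms(1) by (auto simp: borel_probs_imp_space)
  then show ?thesis
    using assms(1,2) by (intro integrable_const_bound) (simp_all add: borel_probs_imp_measurable_eq)
qed

text \<open>Narrow neighbourhoods see only continuous integrands. The Lipschitz (Pasch-Hausdorff)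
  envelopes of \<open>\<phi>\<close> bridge the gap: being minorants, they transfer lower bounds,
  and the common bound \<open>B\<close> permits dominated convergence.\<close>

lemma lsc_on_approx_continuous_below:
  fixes \<phi> :: "'a::metric_space \<Rightarrow> real"
  assumes lsc: "lsc_on S \<phi>" and bdd: "\<And>x. x \<in> S \<Longrightarrow> \<bar>\<phi> x\<bar> \<le> B"
  obtains h :: "nat \<Rightarrow> 'a \<Rightarrow> real"
  where "\<And>k. continuous_on S (h k)" "\<And>k x. x \<in> S \<Longrightarrow> \<bar>h k x\<bar> \<le> B"
    "\<And>k x. x \<in> S \<Longrightarrow> h k x \<le> \<phi> x" "\<And>x. x \<in> S \<Longrightarrow> (\<lambda>k. h k x) \<longlonglongrightarrow> \<phi> x"
proof
  \<comment> \<open>\<open>h k\<close> is the largest \<open>k\<close>-Lipschitz minorant of \<open>\<phi>\<close>.\<close>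
  define h where "h k x = (INF w\<in>S. \<phi> w + real k * dist x w)" for k x
  have lower: "- B \<le> \<phi> w + real k * dist x w" if "w \<in> S" for k x w
    using bdd[OF that] zero_le_dist[of x w] by (smt (verit) mult_nonneg_nonneg of_nat_0_le_iff)
  have bbelow: "bdd_below ((\<lambda>w. \<phi> w + real k * dist x w) ` S)" for k x
    using lower by (auto simp: bdd_below_def)
  have le: "h k x \<le> \<phi> w + real k * dist x w" if "w \<in> S" for k x w
    unfolding h_def using that bbelow by (intro cINF_lower)
  have ge: "c \<le> h k x" if "x \<in> S" "\<And>w. w \<in> S \<Longrightarrow> c \<le> \<phi> w + real k * dist x w" for c k x
    unfolding h_def using that by (intro cINF_greatest) auto
  show h_le: "h k x \<le> \<phi> x" if "x \<in> S" for k x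
    using le[OF that, of k x] by simp
  show "\<bar>h k x\<bar> \<le> B" if "x \<in> S" for k x
    using h_le[OF that, of k] ge[OF that lower, of k] bdd[OF that] by auto
  have Lip: "h k x \<le> h k y + real k * dist x y" if "x \<in> S" "y \<in> S" for k x y
  proof -
    have "h k x - real k * dist x y \<le> \<phi> w + real k * dist y w" if "w \<in> S" for w
    proof -
      have "real k * dist x w \<le> real k * (dist x y + dist y w)"
        by (intro mult_left_mono dist_triangle) auto
      then show ?thesis using le[OF that, of k x] by (simp add: algebra_simps)
    qed
    then show ?thesis using ge[OF \<open>y \<in> S\<close>] by fastforce
  qed
  show "continuous_on S (h k)" for k
  proof -
    have "(real k)-lipschitz_on S (h k)"
    proof (rule lipschitz_onI)
      fix x y assume "x \<in> S" "y \<in> S"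
      then show "dist (h k x) (h k y) \<le> real k * dist x y"
        using Lip[of x y k] Lip[of y x k] by (auto simp: dist_real_def dist_commute abs_le_iff)
    qed simp
    then show ?thesis by (rule lipschitz_on_continuous_on)
  qed
  show "(\<lambda>k. h k x) \<longlonglongrightarrow> \<phi> x" if x: "x \<in> S" for x
  proof (rule order_tendstoI)
    fix c assume "\<phi> x < c"
    then show "\<forall>\<^sub>F k in sequentially. h k x < c"
      using h_le[OF x] by (intro always_eventually allI) (meson le_less_trans)
  next
    fix c assume "c < \<phi> x"
    then obtain c' where c': "c < c'" "c' < \<phi> x" using dense by blast
    then obtain d where "d > 0" and d: "\<And>w. w \<in> S \<Longrightarrow> w \<noteq> x \<Longrightarrow> dist w x < d \<Longrightarrow> c' < \<phi> w"
      using lsc x unfolding lsc_on_def eventually_at by blast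
    \<comment> \<open>Within distance \<open>d\<close> of \<open>x\<close>, semicontinuity keeps
      \<open>\<phi>\<close> above \<open>c'\<close>; farther away, the penalty is at least
      \<open>real N * d\<close>, which outweighs the worst value \<open>- B\<close>.\<close>
    obtain N :: nat where N: "(c' + B) / d \<le> real N" using real_arch_simple by blast
    have "c < h k x" if "k \<ge> N" for k
    proof (rule less_le_trans[OF c'(1)], rule ge[OF x])
      fix w assume w: "w \<in> S"
      show "c' \<le> \<phi> w + real k * dist x w"
      proof (cases "dist w x < d")
        case True
        then have "c' < \<phi> w" using d[OF w] c' by (cases "w = x") auto
        then show ?thesis by (smt (verit) mult_nonneg_nonneg of_nat_0_le_iff zero_le_dist)
      next
        case False
        have "c' + B \<le> real N * d" using N \<open>d > 0\<close> by (simp add: field_simps)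
        also have "\<dots> \<le> real k * dist x w"
          using False that \<open>d > 0\<close> by (intro mult_mono) (auto simp: dist_commute)
        finally show ?thesis using bdd[OF w] by auto
      qed
    qed
    then show "\<forall>\<^sub>F k in sequentially. c < h k x"
      by (auto simp: eventually_sequentially)
  qed
qed

lemma lsc_on_indicator_open:
  assumes "open U"
  shows "lsc_on S (indicator U :: 'a::topological_space \<Rightarrow> real)"
  unfolding lsc_on_def
proof (intro ballI allI impI)
  fix x c assume x: "x \<in> S" and c: "c < (indicator U x :: real)"
  show "\<forall>\<^sub>F y in at x within S. c < (indicator U y :: real)"
  proof (cases "x \<in> U")
    case True
    then have "\<forall>\<^sub>F y in at x within S. y \<in> U"
      using assms by (intro topological_tendstoD[OF tendsto_ident_at])
    then show ?thesis
      by (rule eventually_mono) (use c True in simp)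
  next
    case False
    then show ?thesis
      using c by (intro always_eventually) (simp add: indicator_def)
  qed
qed

lemma tendsto_integral_borel_probs:
  fixes h :: "nat \<Rightarrow> 'a::topological_space \<Rightarrow> real"
  assumes \<mu>: "\<mu> \<in> borel_probs S" and "\<And>k. continuous_on S (h k)" and "\<And>k x. x \<in> S \<Longrightarrow> \<bar>h k x\<bar> \<le> B"
    and "\<phi> \<in> borel_measurable (restrict_space borel S)"
    and "\<And>x. x \<in> S \<Longrightarrow> (\<lambda>k. h k x) \<longlonglongrightarrow> \<phi> x"
  shows "(\<lambda>k. integral\<^sup>L \<mu> (h k)) \<longlonglongrightarrow> integral\<^sup>L \<mu> \<phi>"
proof -
  interpret prob_space \<mu> using \<mu> by (rule borel_probs_imp_prob_space)
  show ?thesis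
  proof (rule integral_dominated_convergence[where w = "\<lambda>_. B"])
    show "\<phi> \<in> borel_measurable \<mu>" "\<And>k. h k \<in> borel_measurable \<mu>"
      using assms by (simp_all add: borel_probs_imp_measurable_eq borel_measurable_continuous_on_restrict)
  qed (use assms in \<open>auto simp: borel_probs_imp_space\<close>)
qed

text \<open>Open sets form an intersection-stable generator, and the indicator of an open set, being
  lower semicontinuous, is a pointwise limit of uniformly bounded continuous functions.\<close>

lemma borel_probs_eqI_bounded_continuous:
  fixes M N :: "'a::metric_space measure"
  assumes M: "M \<in> borel_probs UNIV" and N: "N \<in> borel_probs UNIV"
    and eq: "\<And>h :: 'a \<Rightarrow> real. continuous_on UNIV h \<Longrightarrow> bounded (range h) \<Longrightarrow>
      integral\<^sup>L M h = integral\<^sup>L N h"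
  shows "M = N"
proof (rule measure_eqI_generator_eq[where E = "{U. open U}" and A = "\<lambda>_. UNIV" and \<Omega> = UNIV])
  interpret M: prob_space M using M by (rule borel_probs_imp_prob_space)
  interpret N: prob_space N using N by (rule borel_probs_imp_prob_space)
  have sets: "sets M = sets borel" "sets N = sets borel"
    using M N by (auto simp: borel_probs_def)
  fix U :: "'a set" assume "U \<in> {U. open U}"
  then have U: "open U" by simp
  obtain h :: "nat \<Rightarrow> 'a \<Rightarrow> real" where h: "\<And>k. continuous_on UNIV (h k)" "\<And>k x. \<bar>h k x\<bar> \<le> 1"
    "\<And>x. (\<lambda>k. h k x) \<longlonglongrightarrow> indicator U x"
    by (rule lsc_on_approx_continuous_below[OF lsc_on_indicator_open[OF U, of UNIV], of 1]) auto
  have eq_h: "integral\<^sup>L M (h k) = integral\<^sup>L N (h k)" for k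
    using h(1,2) by (intro eq) (auto simp: bounded_iff)
  have "(indicator U :: 'a \<Rightarrow> real) \<in> borel_measurable (restrict_space borel UNIV)"
    using U by (intro measurable_restrict_space1 borel_measurable_indicator) auto
  then have lim: "(\<lambda>k. integral\<^sup>L P (h k)) \<longlonglongrightarrow> integral\<^sup>L P (indicator U)" if "P \<in> borel_probs UNIV" for P
    using that h by (intro tendsto_integral_borel_probs) auto
  have "integral\<^sup>L M (indicator U) = (integral\<^sup>L N (indicator U) :: real)"
    using LIMSEQ_unique[OF lim[OF M]] lim[OF N] by (simp only: eq_h)
  then show "emeasure M U = emeasure N U"
    using U M N
    by (simp add: borel_probs_imp_space M.emeasure_eq_measure N.emeasure_eq_measure)
next
  interpret M: prob_space M using M by (rule borel_probs_imp_prob_space)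
  show "emeasure M UNIV \<noteq> \<infinity>" for i :: nat
    by simp
  show "sets M = sigma_sets UNIV {U. open U}" "sets N = sigma_sets UNIV {U. open U}"
    using M N by (auto simp: borel_probs_def borel_def)
qed (auto simp: Int_stable_def)

lemma accumulation_point_frequently_integral:
  assumes "accumulation_point (narrow_topology S) \<mu> \<nu>"
    and "continuous_on S h" "bounded (h ` S)" "open (U :: real set)" "integral\<^sup>L \<nu> h \<in> U"
  shows "\<exists>\<^sub>F n in sequentially. integral\<^sup>L (\<mu> n) h \<in> U"
proof -
  have "\<exists>\<^sub>F n in sequentially. \<mu> n \<in> {\<mu> \<in> borel_probs S. integral\<^sup>L \<mu> h \<in> U}"
    using assms(1,5) openin_narrow_topology_subbasis[OF assms(2-4)]
    unfolding accumulation_point_def topspace_narrow_topology by blast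
  then show ?thesis
    by (rule frequently_elim1) simp
qed

text \<open>One continuous minorant \<open>h k\<close> whose \<open>\<nu>\<close>-integral already
  exceeds \<open>c\<close> is fixed before \<open>n\<close> varies. Exceeding \<open>c\<close> is an
  open condition on its integral, hence holds for infinitely many \<open>\<mu> n\<close>, and
  \<open>h k \<le> \<phi>\<close> passes it on to \<open>\<phi>\<close>.\<close>

lemma accumulation_point_frequently_integral_gt:
  fixes S :: "'a::metric_space set"
  assumes acc: "accumulation_point (narrow_topology S) \<mu> \<nu>" and \<mu>: "\<And>n. \<mu> n \<in> borel_probs S"
    and lsc: "lsc_on S \<phi>" and bdd: "bounded (\<phi> ` S)"
    and meas: "\<phi> \<in> borel_measurable (restrict_space borel S)" and c: "c < integral\<^sup>L \<nu> \<phi>"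
  shows "\<exists>\<^sub>F n in sequentially. c < integral\<^sup>L (\<mu> n) \<phi>"
proof -
  obtain B where "\<And>x. x \<in> S \<Longrightarrow> \<bar>\<phi> x\<bar> \<le> B"
    using bdd by (auto simp: bounded_iff)
  then obtain h :: "nat \<Rightarrow> 'a \<Rightarrow> real"
    where h: "\<And>k. continuous_on S (h k)" "\<And>k x. x \<in> S \<Longrightarrow> \<bar>h k x\<bar> \<le> B"
      "\<And>k x. x \<in> S \<Longrightarrow> h k x \<le> \<phi> x" "\<And>x. x \<in> S \<Longrightarrow> (\<lambda>k. h k x) \<longlonglongrightarrow> \<phi> x"
    by (rule lsc_on_approx_continuous_below[OF lsc]) auto
  have bh: "bounded (h k ` S)" for k
    using h(2) by (auto simp: bounded_iff)
  have "\<nu> \<in> borel_probs S"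
    using acc by (simp add: accumulation_point_def)
  then have "(\<lambda>k. integral\<^sup>L \<nu> (h k)) \<longlonglongrightarrow> integral\<^sup>L \<nu> \<phi>"
    using h meas by (intro tendsto_integral_borel_probs) auto
  then obtain k where "c < integral\<^sup>L \<nu> (h k)"
    using eventually_happens'[OF sequentially_bot order_tendstoD(1)[OF _ c]] by auto
  then have "\<exists>\<^sub>F n in sequentially. integral\<^sup>L (\<mu> n) (h k) \<in> {c<..}"
    using h bh by (intro accumulation_point_frequently_integral[OF acc]) auto
  then show ?thesis
  proof (rule frequently_elim1)
    fix n
    have "integral\<^sup>L (\<mu> n) (h k) \<le> integral\<^sup>L (\<mu> n) \<phi>"
    proof (rule integral_mono)
      show "integrable (\<mu> n) (h k)" "integrable (\<mu> n) \<phi>"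
        by (rule integrable_borel_probs_bounded[OF \<mu>]; fact h(1) bh bdd meas borel_measurable_continuous_on_restrict[OF h(1)])+
    qed (simp add: borel_probs_imp_space[OF \<mu>] h(3))
    then show "integral\<^sup>L (\<mu> n) (h k) \<in> {c<..} \<Longrightarrow> c < integral\<^sup>L (\<mu> n) \<phi>"
      by simp
  qed
qed

section \<open>Prokhorov's theorem\<close>

text \<open>The first differing digit contributes \<open>(1/3) ^ Suc n\<close>, and all later digits
  together at most half of that, so the other half remains.\<close>

lemma ternary_expansion_separation:
  fixes a b :: "nat \<Rightarrow> real"
  assumes a: "\<And>i. a i \<in> {0, 1}" and b: "\<And>i. b i \<in> {0, 1}"
    and eq: "\<And>i. i < n \<Longrightarrow> a i = b i" and neq: "a n \<noteq> b n"
  shows "(1/3) ^ Suc n / 2 \<le> \<bar>(\<Sum>i. a i * (1/3) ^ Suc i) - (\<Sum>i. b i * (1/3) ^ Suc i)\<bar>"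
proof -
  define d where "d i = (a i - b i) * (1/3) ^ Suc i" for i
  have geom: "summable (\<lambda>i. (1/3::real) ^ (i + k))" for k
    using summable_geometric[of "1/3::real"] by (simp add: power_add summable_mult2)
  have summ: "summable (\<lambda>i. e i * (1/3) ^ Suc i)" if e: "\<And>i. e i \<in> {0, 1::real}" for e
  proof (rule summable_comparison_test'[OF geom[of 1]])
    show "norm (e i * (1/3) ^ Suc i) \<le> (1/3) ^ (i + 1)" for i
      using e[of i] by auto
  qed
  note sum_a = summ[OF a] and sum_b = summ[OF b]
  have abs_diff: "\<bar>a i - b i\<bar> \<le> 1" for i
    using a[of i] b[of i] by auto
  have d_le: "norm (d i) \<le> (1/3) ^ Suc i" for i
    using abs_diff[of i] by (simp add: d_def abs_mult mult_left_le_one_le)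
  have sum_d: "summable d"
    unfolding d_def left_diff_distrib by (rule summable_diff[OF sum_a sum_b])
  have "\<bar>\<Sum>i. d (i + Suc n)\<bar> \<le> (\<Sum>i. (1/3) ^ (i + (n + 2)))"
  proof (rule order_trans[OF summable_rabs])
    have le: "\<bar>d (i + Suc n)\<bar> \<le> (1/3) ^ (i + (n + 2))" for i
      using d_le[of "i + Suc n"] by (simp del: power_Suc)
    show s: "summable (\<lambda>i. \<bar>d (i + Suc n)\<bar>)"
      by (rule summable_comparison_test'[OF geom[of "n + 2"]]) (use le in simp)
    show "(\<Sum>i. \<bar>d (i + Suc n)\<bar>) \<le> (\<Sum>i. (1/3) ^ (i + (n + 2)))"
      by (rule suminf_le[OF le s geom])
  qed
  also have "(\<Sum>i. (1/3::real) ^ (i + (n + 2))) = (1/3) ^ Suc n / 2"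
    using suminf_mult2[OF summable_geometric[of "1/3::real"], of "(1/3) ^ (n + 2)"]
      suminf_geometric[of "1/3::real"]
    by (simp add: power_add)
  finally have tail: "\<bar>\<Sum>i. d (i + Suc n)\<bar> \<le> (1/3) ^ Suc n / 2" .
  have "(\<Sum>i. a i * (1/3) ^ Suc i) - (\<Sum>i. b i * (1/3) ^ Suc i) = suminf d"
    unfolding d_def left_diff_distrib by (rule suminf_diff[OF sum_a sum_b])
  also have "\<dots> = (\<Sum>i. d (i + Suc n)) + d n"
    using suminf_split_initial_segment[OF sum_d, of "Suc n"] eq by (simp add: d_def)
  finally have "(\<Sum>i. a i * (1/3) ^ Suc i) - (\<Sum>i. b i * (1/3) ^ Suc i)
    = (\<Sum>i. d (i + Suc n)) + d n" .
  moreover have "\<bar>d n\<bar> = (1/3) ^ Suc n"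
  proof -
    have "\<bar>a n - b n\<bar> = 1" using a[of n] b[of n] neq by auto
    then show ?thesis by (simp add: d_def abs_mult)
  qed
  ultimately show ?thesis using tail by linarith
qed

text \<open>The sets \<open>A i\<close> enumerate a countable basis. Basis sets of small diameter
  cover \<open>K\<close>, finitely many suffice, and \<open>k\<close> bounds their indices; a point
  \<open>y\<close> anywhere in the space that agrees with \<open>x\<close> up to \<open>k\<close>
  lies in the same small set as \<open>x\<close>.\<close>

lemma second_countable_separating_sequence:
  obtains A :: "nat \<Rightarrow> 'a::{metric_space, second_countable_topology} set"
  where "\<And>i. open (A i)"
    "\<And>K \<epsilon>. compact K \<Longrightarrow> 0 < \<epsilon> \<Longrightarrow>
      \<exists>k. \<forall>x\<in>K. \<forall>y. (\<forall>i\<le>k. x \<in> A i \<longleftrightarrow> y \<in> A i) \<longrightarrow> dist x y < \<epsilon>"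
proof -
  obtain B :: "'a set set" where B: "countable B" "topological_basis B"
    using ex_countable_basis by blast
  \<comment> \<open>\<open>from_nat_into\<close> has range \<open>B\<close> only for a non-empty
    \<open>B\<close>.\<close>
  then have "B \<noteq> {}"
    using topological_basisE[OF B(2) open_UNIV, of undefined] by auto
  with B(1) have range: "range (from_nat_into B) = B"
    by simp
  have op: "open (from_nat_into B i)" for i
    using range topological_basis_open[OF B(2)] by blast
  have "\<exists>k. \<forall>x\<in>K. \<forall>y. (\<forall>i\<le>k. x \<in> from_nat_into B i \<longleftrightarrow> y \<in> from_nat_into B i) \<longrightarrow> dist x y < \<epsilon>"
    if K: "compact K" and \<epsilon>: "0 < \<epsilon>" for K and \<epsilon> :: real
  proof -
    define C where "C = {i. \<forall>u\<in>from_nat_into B i. \<forall>v\<in>from_nat_into B i. dist u v < \<epsilon>}"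
    have "x \<in> (\<Union>i\<in>C. from_nat_into B i)" for x
    proof -
      obtain U where U: "U \<in> B" "x \<in> U" "U \<subseteq> ball x (\<epsilon> / 2)"
        using topological_basisE[OF B(2) open_ball, of x x "\<epsilon> / 2"] \<epsilon> by auto
      then obtain i where i: "U = from_nat_into B i"
        using range by blast
      have "dist u v < \<epsilon>" if "u \<in> U" "v \<in> U" for u v
      proof (rule dist_triangle_half_r)
        show "dist x u < \<epsilon> / 2" "dist x v < \<epsilon> / 2"
          using that U(3) by auto
      qed
      then have "i \<in> C"
        unfolding C_def i by blast
      then show ?thesis
        using U(2) unfolding i by (rule UN_I)
    qed
    then have "K \<subseteq> (\<Union>i\<in>C. from_nat_into B i)"
      by (rule subsetI)
    then obtain C' where C': "C' \<subseteq> C" "finite C'" "K \<subseteq> (\<Union>i\<in>C'. from_nat_into B i)"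
      by (rule compactE_image[OF K op])
    then obtain k where k: "\<forall>i\<in>C'. i \<le> k"
      using finite_nat_set_iff_bounded_le by auto
    have "dist x y < \<epsilon>"
      if "x \<in> K" "\<forall>i\<le>k. x \<in> from_nat_into B i \<longleftrightarrow> y \<in> from_nat_into B i" for x y
    proof -
      obtain i where "i \<in> C'" "x \<in> from_nat_into B i"
        using C'(3) \<open>x \<in> K\<close> by blast
      then have "y \<in> from_nat_into B i" "i \<in> C"
        using that(2) k C'(1) by blast+
      then show ?thesis
        using \<open>x \<in> from_nat_into B i\<close> unfolding C_def by blast
    qed
    then show ?thesis
      by blast
  qed
  with op show ?thesis by (rule that)
qed

text \<open>The code of \<open>x\<close> has the ternary digits \<open>indicator (A i) x\<close>.
  The last property expresses uniform continuity of the inverse on each compact set, since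
  \<open>c\<close> itself may jump.\<close>

lemma borel_code_in_real:
  obtains c :: "'a::{metric_space, second_countable_topology} \<Rightarrow> real"
  where "c \<in> borel_measurable borel" "\<And>x. 0 \<le> c x" "\<And>x. c x \<le> 1/2"
    "\<And>K \<epsilon>. compact K \<Longrightarrow> 0 < \<epsilon> \<Longrightarrow>
      \<exists>\<delta>>0. \<forall>x\<in>K. \<forall>y. \<bar>c x - c y\<bar> < \<delta> \<longrightarrow> dist x y < \<epsilon>"
proof -
  obtain A :: "nat \<Rightarrow> 'a set" where A: "\<And>i. open (A i)"
    and sep: "\<And>K \<epsilon>. compact K \<Longrightarrow> 0 < \<epsilon> \<Longrightarrow>
      \<exists>k. \<forall>x\<in>K. \<forall>y. (\<forall>i\<le>k. x \<in> A i \<longleftrightarrow> y \<in> A i) \<longrightarrow> dist x y < \<epsilon>"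
    using second_countable_separating_sequence by blast
  define c where "c x = (\<Sum>i. indicator (A i) x * (1/3::real) ^ Suc i)" for x
  have geom: "(\<lambda>i. (1/3::real) ^ Suc i) sums (1/2)"
    using sums_mult[OF geometric_sums[of "1/3::real"], of "1/3"] by simp
  have summ: "summable (\<lambda>i. indicator (A i) x * (1/3::real) ^ Suc i)" for x
    using sums_summable[OF geom]
    by (rule summable_comparison_test') (auto simp: indicator_def)
  show ?thesis
  proof
    show "c \<in> borel_measurable borel"
      unfolding c_def using A
      by (intro borel_measurable_suminf borel_measurable_times borel_measurable_indicator) auto
    show "0 \<le> c x" for x
      unfolding c_def by (intro suminf_nonneg summ) auto
    have "c x \<le> (\<Sum>i. (1/3::real) ^ Suc i)" for x
      unfolding c_def
      by (intro suminf_le summ sums_summable[OF geom]) (auto simp: indicator_def)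
    then show "c x \<le> 1/2" for x
      unfolding sums_unique[OF geom, symmetric] .
    fix K :: "'a set" and \<epsilon> :: real
    assume "compact K" "0 < \<epsilon>"
    then obtain k where k: "\<And>x y. x \<in> K \<Longrightarrow> (\<And>i. i \<le> k \<Longrightarrow> x \<in> A i \<longleftrightarrow> y \<in> A i) \<Longrightarrow> dist x y < \<epsilon>"
      using sep by meson
    \<comment> \<open>The threshold is the separation forced by a first difference at digit
      \<open>k\<close>, the smallest among the digits up to \<open>k\<close>; closer codes agree on
      all of them.\<close>
    have "dist x y < \<epsilon>" if x: "x \<in> K" and close: "\<bar>c x - c y\<bar> < (1/3) ^ Suc k / 2" for x y
    proof (rule k[OF x], rule ccontr)
      fix i assume i: "i \<le> k" "(x \<in> A i) \<noteq> (y \<in> A i)"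
      define n where "n = (LEAST i. (x \<in> A i) \<noteq> (y \<in> A i))"
      have n: "(x \<in> A n) \<noteq> (y \<in> A n)"
        unfolding n_def using i(2) by (rule LeastI)
      have "n \<le> i"
        unfolding n_def using i(2) by (rule Least_le)
      have "(1/3) ^ Suc n / 2 \<le> \<bar>c x - c y\<bar>"
        unfolding c_def
      proof (rule ternary_expansion_separation)
        fix i assume "i < n"
        then show "indicator (A i) x = (indicator (A i) y :: real)"
          unfolding n_def by (auto dest: not_less_Least simp: indicator_def)
      qed (use n in \<open>auto simp: indicator_def\<close>)
      moreover have "(1/3::real) ^ Suc k \<le> (1/3) ^ Suc n"
        using \<open>n \<le> i\<close> i(1) by (intro power_decreasing) auto
      ultimately show False using close by linarith
    qed
    then show "\<exists>\<delta>>0. \<forall>x\<in>K. \<forall>y. \<bar>c x - c y\<bar> < \<delta> \<longrightarrow> dist x y < \<epsilon>"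
      by (intro exI[of _ "(1/3) ^ Suc k / 2"]) auto
  qed
qed

text \<open>Each point is coded at its first level \<open>j\<close>, in the interval from
  \<open>j\<close> to \<open>j + 1/2\<close>. On each level the inverse is uniformly continuous and
  extends to the closure of the codes; the gaps between levels make the union closed and the glued
  inverse continuous.\<close>

lemma sigma_compact_code_in_real:
  fixes K :: "nat \<Rightarrow> 'a::{complete_space, second_countable_topology} set"
  assumes K: "\<And>j. compact (K j)"
  obtains s :: "'a \<Rightarrow> real" and q :: "real \<Rightarrow> 'a" and D :: "real set"
  where "s \<in> borel_measurable borel" "closed D" "continuous_on D q" "q ` D \<subseteq> (\<Union>j. K j)"
    "\<And>x. x \<in> (\<Union>j. K j) \<Longrightarrow> s x \<in> D \<and> q (s x) = x"
    "\<And>j x. x \<in> K j \<Longrightarrow> 0 \<le> s x \<and> s x < real (Suc j)"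
proof -
  obtain c :: "'a \<Rightarrow> real"
    where c: "c \<in> borel_measurable borel" "\<And>x. 0 \<le> c x" "\<And>x. c x \<le> 1/2"
    and sep: "\<And>K \<epsilon>. compact K \<Longrightarrow> 0 < \<epsilon> \<Longrightarrow>
      \<exists>\<delta>>0. \<forall>x\<in>K. \<forall>y. \<bar>c x - c y\<bar> < \<delta> \<longrightarrow> dist x y < \<epsilon>"
    by (rule borel_code_in_real) (rule that)
  define level where "level x = (LEAST j. x \<in> K j)" for x
  \<comment> \<open>As \<open>0 \<le> c \<le> 1/2\<close>, different levels are coded at distance at least \<open>1/2\<close>.\<close>
  define s where "s x = real (level x) + c x" for x
  define L where "L j = {x \<in> K j. level x = j}" for j
  have level: "x \<in> K (level x)" "level x \<le> j" if "x \<in> K j" for x j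
    unfolding level_def using that by (auto intro: LeastI Least_le)
  have dist_s: "\<bar>c x - c y\<bar> = dist (s x) (s y)" if "x \<in> L j" "y \<in> L j" for x y j
    using that by (simp add: s_def L_def dist_real_def)
  have inj: "inj_on s (L j)" for j
  proof (rule inj_onI)
    fix x y assume xy: "x \<in> L j" "y \<in> L j" "s x = s y"
    then have "x \<in> K j" "c x = c y"
      using dist_s[of x j y] by (simp_all add: L_def)
    then have "dist x y < \<epsilon>" if "0 < \<epsilon>" for \<epsilon>
      using sep[OF K[of j] that] by fastforce
    then have "\<not> 0 < dist x y"
      by (meson less_irrefl)
    then show "x = y"
      by simp
  qed
  have "uniformly_continuous_on (s ` L j) (inv_into (L j) s)" for j
    unfolding uniformly_continuous_on_def
  proof (intro allI impI)
    fix \<epsilon> :: real assume "0 < \<epsilon>"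
    from sep[OF K[of j] this]
    obtain \<delta> where "\<delta> > 0" and \<delta>: "\<forall>x\<in>K j. \<forall>y. \<bar>c x - c y\<bar> < \<delta> \<longrightarrow> dist x y < \<epsilon>"
      by blast
    have "dist x y < \<epsilon>" if "x \<in> L j" "y \<in> L j" "dist (s x) (s y) < \<delta>" for x y
      using \<delta> that dist_s[OF that(1,2)] by (simp add: L_def)
    then show "\<exists>d>0. \<forall>t\<in>s ` L j. \<forall>t'\<in>s ` L j. dist t' t < d \<longrightarrow>
        dist (inv_into (L j) s t') (inv_into (L j) s t) < \<epsilon>"
      using \<open>\<delta> > 0\<close> inj[of j] by (intro exI[of _ \<delta>]) simp
  qed
  then have "\<exists>g. uniformly_continuous_on (closure (s ` L j)) g \<and>
      (\<forall>t\<in>s ` L j. inv_into (L j) s t = g t)" for j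
    by (rule uniformly_continuous_on_extension_on_closure) blast
  then obtain g where g: "\<And>j. uniformly_continuous_on (closure (s ` L j)) (g j) \<and>
      (\<forall>t\<in>s ` L j. inv_into (L j) s t = g j t)"
    using choice[of "\<lambda>j g. uniformly_continuous_on (closure (s ` L j)) g \<and>
      (\<forall>t\<in>s ` L j. inv_into (L j) s t = g t)"] by blast
  have g_s: "g j (s x) = x" if "x \<in> L j" for j x
    using g[of j] that inv_into_f_f[OF inj that] by simp
  define D where "D = (\<Union>j. closure (s ` L j))"
  \<comment> \<open>The integer part recovers the level, also on the closures, which stay inside the
    same intervals.\<close>
  define q where "q t = g (nat \<lfloor>t\<rfloor>) t" for t
  have g_cont: "continuous_on (closure (s ` L j)) (g j)" for j
    using g by (intro uniformly_continuous_imp_continuous) blast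
  have bounds: "real j \<le> t \<and> t \<le> real j + 1/2" if "t \<in> closure (s ` L j)" for t j
  proof -
    have "s ` L j \<subseteq> {real j..real j + 1/2}"
      using c(2,3) by (auto simp: s_def L_def)
    then have "closure (s ` L j) \<subseteq> {real j..real j + 1/2}"
      by (rule closure_minimal) simp
    with that show ?thesis
      by auto
  qed
  \<comment> \<open>Thus each closure is relatively open in \<open>D\<close>. This yields both the
    closedness of \<open>D\<close> and the continuity of \<open>q\<close>, which can be checked on
    one level.\<close>
  have same: "t' \<in> closure (s ` L i)"
    if "t \<in> closure (s ` L i)" "t' \<in> D" "dist t t' < 1/2" for t t' i
  proof -
    obtain j where j: "t' \<in> closure (s ` L j)"
      using \<open>t' \<in> D\<close> unfolding D_def by (rule UN_E)
    have "i = j"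
    proof (rule ccontr)
      assume "i \<noteq> j"
      then have "real i + 1 \<le> real j \<or> real j + 1 \<le> real i" by linarith
      then show False
        using bounds[OF that(1)] bounds[OF j] that(3) by (auto simp: dist_real_def abs_less_iff)
    qed
    with j show ?thesis by simp
  qed
  have q_eq: "q t = g j t" if "t \<in> closure (s ` L j)" for t j
  proof -
    have "nat \<lfloor>t\<rfloor> = j"
      using bounds[OF that] by (simp add: floor_eq_iff nat_eq_iff)
    then show ?thesis by (simp add: q_def)
  qed
  show ?thesis
  proof (rule that[where s = s and q = q and D = D])
    have [measurable]: "K j \<in> sets borel" for j
      using K by (intro borel_closed compact_imp_closed)
    note c(1)[measurable]
    show "s \<in> borel_measurable borel"
      unfolding s_def level_def by measurable
    show "closed D"
      unfolding closed_sequential_limits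
    proof (intro allI impI, elim conjE)
      fix x l assume x: "\<forall>n. x n \<in> D" and lim: "x \<longlonglongrightarrow> l"
      obtain N where N: "\<And>n. n \<ge> N \<Longrightarrow> dist (x n) l < 1/4"
        using metric_LIMSEQ_D[OF lim, of "1/4"] zero_less_divide_1_iff zero_less_numeral by blast
      have "x N \<in> D" using x by (rule spec)
      then obtain i where i: "x N \<in> closure (s ` L i)"
        unfolding D_def by (rule UN_E)
      have "x n \<in> closure (s ` L i)" if "n \<ge> N" for n
      proof (rule same[OF i])
        show "x n \<in> D" using x by (rule spec)
        show "dist (x N) (x n) < 1/2"
          using N[OF that] N[OF order_refl] dist_triangle2[of "x N" "x n" l] by linarith
      qed
      then have "l \<in> closure (s ` L i)"
        by (intro Lim_in_closed_set[OF closed_closure _ sequentially_bot lim]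
            eventually_sequentiallyI)
      then show "l \<in> D"
        unfolding D_def by (rule UN_I[OF UNIV_I])
    qed
    show "continuous_on D q"
      unfolding continuous_on_eq_continuous_within
    proof
      fix t assume "t \<in> D"
      then obtain j where j: "t \<in> closure (s ` L j)"
        unfolding D_def by (rule UN_E)
      have "continuous_on (closure (s ` L j)) q"
        using g_cont[of j] by (rule continuous_on_eq) (simp add: q_eq[of _ j])
      then have "continuous (at t within closure (s ` L j)) q"
        using j by (simp add: continuous_on_eq_continuous_within)
      moreover have "at t within D = at t within closure (s ` L j)"
      proof (rule at_within_nhd[of t "ball t (1/2)"])
        have "D \<inter> ball t (1/2) \<subseteq> closure (s ` L j)"
          using same[OF j] by auto
        moreover have "closure (s ` L j) \<subseteq> D"
          unfolding D_def by blast
        ultimately show "D \<inter> ball t (1/2) - {t} = closure (s ` L j) \<inter> ball t (1/2) - {t}"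
          by blast
      qed auto
      ultimately show "continuous (at t within D) q" by simp
    qed
    \<comment> \<open>Compactness keeps the extended values in \<open>K j\<close>; this is what
      later places the limit measure on \<open>S\<close>.\<close>
    have "g j ` closure (s ` L j) \<subseteq> K j" for j
    proof (rule image_closure_subset[OF g_cont compact_imp_closed[OF K]])
      show "g j ` s ` L j \<subseteq> K j"
      proof clarify
        fix x assume x: "x \<in> L j"
        then show "g j (s x) \<in> K j"
          unfolding g_s[OF x] by (simp add: L_def)
      qed
    qed
    then have "q t \<in> K j" if "t \<in> closure (s ` L j)" for t j
      using that unfolding q_eq[OF that] by blast
    then show "q ` D \<subseteq> (\<Union>j. K j)"
      unfolding D_def by blast
    show "s x \<in> D \<and> q (s x) = x" if mem: "x \<in> (\<Union>j. K j)" for x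
    proof -
      obtain j where j: "x \<in> K j"
        using mem by blast
      have x: "x \<in> L (level x)"
        unfolding L_def using level(1)[OF j] by simp
      then have sx: "s x \<in> closure (s ` L (level x))"
        by (intro subsetD[OF closure_subset] imageI)
      then have "s x \<in> D"
        unfolding D_def by blast
      moreover have "q (s x) = x"
        unfolding q_eq[OF sx] by (rule g_s[OF x])
      ultimately show ?thesis ..
    qed
    show "0 \<le> s x \<and> s x < real (Suc j)" if "x \<in> K j" for j x
    proof -
      have "real (level x) \<le> real j" using level(2)[OF that] by simp
      then show ?thesis using c(2,3)[of x] by (simp add: s_def)
    qed
  qed
qed

text \<open>The images under \<open>s\<close> are tight on the real line. Their weak limit
  \<open>M\<close> is carried by the closed set \<open>D\<close>, where \<open>q\<close> is defined
  and continuous, and its image under \<open>q\<close> is the narrow limit.\<close>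

theorem tight_seq_imp_convergent_subseq:
  fixes S :: "'a::{complete_space, second_countable_topology} set"
  assumes \<mu>: "\<And>n. \<mu> n \<in> borel_probs S" and tight: "tight_seq S \<mu>"
  obtains r \<nu> where "strict_mono r" "limitin (narrow_topology S) (\<mu> \<circ> r) \<nu> sequentially"
proof -
  interpret \<mu>: prob_space "\<mu> n" for n
    using \<mu> by (rule borel_probs_imp_prob_space)
  have "\<exists>K. compact K \<and> K \<subseteq> S \<and> (\<forall>n. measure (\<mu> n) K \<ge> 1 - 1 / real (Suc j))" for j
    using tight unfolding tight_seq_def by simp
  then obtain K where K: "\<And>j. compact (K j)" "\<And>j. K j \<subseteq> S"
    and mK: "\<And>j n. measure (\<mu> n) (K j) \<ge> 1 - 1 / real (Suc j)"
    by metis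
  obtain s :: "'a \<Rightarrow> real" and q D
    where s: "s \<in> borel_measurable borel" and D: "closed D" and q: "continuous_on D q"
      and qD: "q ` D \<subseteq> (\<Union>j. K j)" and sq: "\<And>x. x \<in> (\<Union>j. K j) \<Longrightarrow> s x \<in> D \<and> q (s x) = x"
      and s_bounds: "\<And>j x. x \<in> K j \<Longrightarrow> 0 \<le> s x \<and> s x < real (Suc j)"
    by (rule sigma_compact_code_in_real[of K, OF K(1)]) (rule that)
  have qS: "q t \<in> S" if "t \<in> D" for t
    using qD K(2) that by blast
  have space: "space (\<mu> n) = S" for n
    using \<mu> by (rule borel_probs_imp_space)
  have sets: "sets (\<mu> n) = sets (restrict_space borel S)" for n
    using \<mu> by (simp add: borel_probs_def)
  have K_sets: "K j \<in> sets (\<mu> n)" for j n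
  proof -
    have "S \<inter> K j \<in> sets (restrict_space borel S)"
      unfolding sets_restrict_space by (intro imageI borel_closed compact_imp_closed K(1))
    then show ?thesis
      using K(2) by (simp add: sets Int_absorb1)
  qed
  have AE_K: "AE x in \<mu> n. x \<in> (\<Union>j. K j)" for n
  proof (rule \<mu>.AE_prob_1)
    have "1 - 1 / real (Suc j) \<le> measure (\<mu> n) (\<Union>j. K j)" for j
      using K_sets by (intro order_trans[OF mK \<mu>.finite_measure_mono]) auto
    moreover have "(\<lambda>j. 1 - 1 / real (Suc j)) \<longlonglongrightarrow> 1 - 0"
      by (intro tendsto_intros LIMSEQ_inverse_real_of_nat[unfolded inverse_eq_divide])
    ultimately have "1 \<le> measure (\<mu> n) (\<Union>j. K j)"
      by (intro LIMSEQ_le_const2[of "\<lambda>j. 1 - 1 / real (Suc j)"]) auto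
    then show "\<mu>.prob n (\<Union>j. K j) = 1"
      using \<mu>.prob_le_1 by (intro antisym) auto
  qed
  have s_meas: "s \<in> borel_measurable (\<mu> n)" for n
    unfolding borel_probs_imp_measurable_eq[OF \<mu>] by (rule measurable_restrict_space1[OF s])

  \<comment> \<open>Image measures on the real line and Helly selection\<close>
  define \<kappa> where "\<kappa> n = distr (\<mu> n) borel s" for n
  have \<kappa>_real: "real_distribution (\<kappa> n)" for n
    unfolding \<kappa>_def using s_meas by (rule \<mu>.real_distribution_distr)
  have "tight \<kappa>"
    unfolding tight_def
  proof (intro conjI allI impI)
    fix \<epsilon> :: real assume "\<epsilon> > 0"
    then obtain j where j: "1 / real (Suc j) < \<epsilon>"
      using reals_Archimedean[of \<epsilon>] by (auto simp: inverse_eq_divide)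
    \<comment> \<open>\<open>tight\<close> asks for intervals open on the left; the endpoint
      \<open>-1\<close> keeps the possible code 0 inside.\<close>
    have "1 - \<epsilon> < measure (\<kappa> n) {-1<..real (Suc j)}" for n
    proof -
      have "1 - \<epsilon> < measure (\<mu> n) (K j)"
        using mK[of j n] j by simp
      also have "\<dots> \<le> measure (\<mu> n) (s -` {-1<..real (Suc j)} \<inter> space (\<mu> n))"
      proof (rule \<mu>.finite_measure_mono)
        show "K j \<subseteq> s -` {-1<..real (Suc j)} \<inter> space (\<mu> n)"
          using s_bounds[of _ j] K(2)[of j] by (fastforce simp: space)
      qed (rule measurable_sets[OF s_meas], simp)
      also have "\<dots> = measure (\<kappa> n) {-1<..real (Suc j)}"
        unfolding \<kappa>_def by (rule measure_distr[OF s_meas, symmetric]) simp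
      finally show ?thesis .
    qed
    then show "\<exists>a b. a < b \<and> (\<forall>n. 1 - \<epsilon> < measure (\<kappa> n) {a<..b})"
      by (intro exI[of _ "-1"] exI[of _ "real (Suc j)"]) simp
  qed (rule \<kappa>_real)
  then obtain r M where r: "strict_mono r" and M: "real_distribution M"
    and conv: "weak_conv_m (\<kappa> \<circ> id \<circ> r) M"
    using tight_imp_convergent_subsubsequence[OF _ strict_mono_id] by blast
  interpret M: real_distribution M by (rule M)
  have conv_M: "(\<lambda>n. \<integral>x. H (s x) \<partial>\<mu> (r n)) \<longlonglongrightarrow> integral\<^sup>L M H"
    if H: "continuous_on UNIV H" "\<And>t. \<bar>H t\<bar> \<le> B" for H :: "real \<Rightarrow> real" and B
  proof -
    have "(\<lambda>n. integral\<^sup>L ((\<kappa> \<circ> id \<circ> r) n) H) \<longlonglongrightarrow> integral\<^sup>L M H"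
    proof (rule weak_conv_imp_integral_bdd_continuous_conv[OF _ M conv])
      show "isCont H t" for t
        using H(1) by (simp add: continuous_on_eq_continuous_at)
      show "norm (H t) \<le> B" for t
        using H(2) by simp
    qed (simp add: \<kappa>_real)
    moreover have "integral\<^sup>L (\<kappa> n) H = (\<integral>x. H (s x) \<partial>\<mu> n)" for n
      unfolding \<kappa>_def
      using borel_measurable_continuous_onI[OF H(1)] by (rule integral_distr[OF s_meas])
    ultimately show ?thesis by simp
  qed
  have "S \<noteq> {}"
    using \<mu>.not_empty[of 0] by (simp add: space)
  then obtain z where z: "z \<in> S" by blast
  \<comment> \<open>\<open>infdist\<close> to the empty set is 0 by convention, so it detects
    membership in \<open>D\<close> only when \<open>D\<close> is non-empty.\<close>
  have "D \<noteq> {}"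
  proof
    assume "D = {}"
    then have "(\<Union>j. K j) = {}" using sq by blast
    then show False using AE_K[of 0] \<mu>.AE_False by simp
  qed
  have AE_D: "AE t in M. t \<in> D"
  proof -
    \<comment> \<open>This \<open>H\<close> is bounded, continuous and non-negative, and vanishes
      exactly on \<open>D\<close>; its integral is 0 along the sequence, hence also for
      \<open>M\<close>.\<close>
    define H where "H t = min 1 (infdist t D)" for t
    have H: "continuous_on UNIV H" "\<And>t. \<bar>H t\<bar> \<le> 1"
      unfolding H_def by (intro continuous_intros) (simp add: infdist_nonneg)
    have "(\<integral>x. H (s x) \<partial>\<mu> n) = 0" for n
    proof (rule integral_eq_zero_AE)
      show "AE x in \<mu> n. H (s x) = 0"
        using AE_K[of n] by eventually_elim (use sq in \<open>simp add: H_def\<close>)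
    qed
    then have "integral\<^sup>L M H = 0"
      using LIMSEQ_unique[OF conv_M[OF H]] by simp
    moreover have "integrable M H"
      using H(2) borel_measurable_continuous_onI[OF H(1)]
      by (intro M.integrable_const_bound[of _ 1]) simp_all
    ultimately have "AE t in M. H t = 0"
      by (subst (asm) integral_nonneg_eq_0_iff_AE) (auto simp: H_def infdist_nonneg)
    then show ?thesis
      by eventually_elim
        (use in_closed_iff_infdist_zero[OF D \<open>D \<noteq> {}\<close>] in \<open>auto simp: H_def min_def split: if_splits\<close>)
  qed
  \<comment> \<open>The value \<open>z\<close> is taken only on an \<open>M\<close>-null set; it
    makes the map total with values in \<open>S\<close>.\<close>
  define q' where "q' t = (if t \<in> D then q t else z)" for t
  have q'_meas: "q' \<in> measurable M (restrict_space borel S)"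
  proof (rule measurable_restrict_space2)
    show "q' \<in> space M \<rightarrow> S"
      using qS z by (auto simp: q'_def)
    have "q' \<in> borel_measurable borel"
      unfolding q'_def using D q by (intro borel_measurable_continuous_on_if) auto
    then show "q' \<in> borel_measurable M"
      by simp
  qed
  define \<nu> where "\<nu> = distr M (restrict_space borel S) q'"
  have \<nu>: "\<nu> \<in> borel_probs S"
    using M.prob_space_distr[OF q'_meas] by (simp add: borel_probs_def \<nu>_def)
  have "(\<lambda>n. integral\<^sup>L ((\<mu> \<circ> r) n) h) \<longlonglongrightarrow> integral\<^sup>L \<nu> h"
    if h: "continuous_on S h" "bounded (h ` S)" for h :: "'a \<Rightarrow> real"
  proof -
    obtain B where B: "\<And>x. x \<in> S \<Longrightarrow> \<bar>h x\<bar> \<le> B"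
      using h(2) by (auto simp: bounded_iff)
    have "0 \<le> B" using B[OF z] by simp
    have hq: "- B \<le> h (q t)" "h (q t) \<le> B" if "t \<in> D" for t
      using B[OF qS[OF that]] by (simp_all add: abs_le_iff)
    have "continuous_on D (h \<circ> q)"
      by (rule continuous_on_compose[OF q continuous_on_subset[OF h(1)]]) (use qS in blast)
    \<comment> \<open>Tietze extension turns \<open>h\<close> into a bounded test function on the
      line with \<open>H (s x) = h x\<close> almost surely. Weak convergence tested with
      \<open>H\<close> is then narrow convergence tested with \<open>h\<close>.\<close>
    then obtain H where H: "continuous_on UNIV H" "\<And>t. t \<in> D \<Longrightarrow> H t = (h \<circ> q) t"
      "\<And>t. t \<in> UNIV \<Longrightarrow> H t \<in> cbox (- B) B"
      by (rule Tietze_closed_interval_1[of D "h \<circ> q" UNIV "- B" B])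
        (use D hq \<open>0 \<le> B\<close> in auto)
    have H_meas: "H \<in> borel_measurable borel"
      using H(1) by (rule borel_measurable_continuous_onI)
    have h_meas: "h \<in> borel_measurable (restrict_space borel S)"
      using h(1) by (rule borel_measurable_continuous_on_restrict)
    have "(\<lambda>n. \<integral>x. H (s x) \<partial>\<mu> (r n)) \<longlonglongrightarrow> integral\<^sup>L M H"
    proof (rule conv_M[OF H(1)])
      show "\<bar>H t\<bar> \<le> B" for t
        using H(3)[of t] by (simp add: abs_le_iff)
    qed
    moreover have "(\<integral>x. H (s x) \<partial>\<mu> n) = integral\<^sup>L (\<mu> n) h" for n
    proof (rule integral_cong_AE)
      show "AE x in \<mu> n. H (s x) = h x"
        using AE_K[of n] by eventually_elim (use sq H(2) in simp)
      show "(\<lambda>x. H (s x)) \<in> borel_measurable (\<mu> n)"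
        by (rule measurable_compose[OF s_meas H_meas])
      show "h \<in> borel_measurable (\<mu> n)"
        unfolding borel_probs_imp_measurable_eq[OF \<mu>] by (rule h_meas)
    qed
    moreover have "integral\<^sup>L M H = integral\<^sup>L \<nu> h"
    proof -
      have "integral\<^sup>L M H = (\<integral>t. h (q' t) \<partial>M)"
      proof (rule integral_cong_AE)
        show "AE t in M. H t = h (q' t)"
          using AE_D by eventually_elim (simp add: H(2) q'_def)
        show "(\<lambda>t. h (q' t)) \<in> borel_measurable M"
          by (rule measurable_compose[OF q'_meas h_meas])
      qed (simp add: H_meas)
      also have "\<dots> = integral\<^sup>L \<nu> h"
        unfolding \<nu>_def by (rule integral_distr[OF q'_meas h_meas, symmetric])
      finally show ?thesis .
    qed
    ultimately show ?thesis by simp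
  qed
  then have "limitin (narrow_topology S) (\<mu> \<circ> r) \<nu> sequentially"
    by (subst limitin_narrow_topology_iff) (simp_all add: \<mu> \<nu>)
  with r show ?thesis by (rule that)
qed

section \<open>Minimizing sequences\<close>

theorem proposition3p6:
  fixes F :: "'a::polish_space \<Rightarrow> 'b::polish_space set"
    and g :: "'a \<times> 'b \<Rightarrow> 'h::{real_inner, banach, second_countable_topology}"
    and f :: "'h \<Rightarrow> real"
    and m :: "'a measure"
    and \<mu> :: "nat \<Rightarrow> ('a \<times> 'b) measure"
  assumes F_nonempty: "\<And>x. F x \<noteq> {}"
    and F_closed_graph: "closed (graph F)"
    and g_measurable: "g \<in> borel_measurable (restrict_space borel (graph F))"
    and f_measurable: "f \<in> borel_measurable borel"
    and m: "m \<in> borel_probs UNIV"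
    and g_bounded: "bounded (g ` graph F)"
    and f_convex: "convex_on UNIV f"
    and f_differentiable: "\<And>v. f differentiable (at v)"
    and gradient_lipschitz: "\<exists>L. L-lipschitz_on UNIV (gradient f)"
    and g_lsc: "\<And>l. l \<in> range (gradient f) \<Longrightarrow> lsc_on (graph F) (\<lambda>z. inner l (g z))"
    and G_lsc: "\<And>l. l \<in> range (gradient f) \<Longrightarrow>
                  lsc_setmap (\<lambda>x. {inner l (g (x, y)) | y. y \<in> F x})"
    and BR_nonempty: "\<And>l x. l \<in> range (gradient f) \<Longrightarrow> best_response F g l x \<noteq> {}"
    and minimizing: "minimizing_sequence (\<lambda>\<nu>. f (integral\<^sup>L \<nu> g)) (probs_with_marginal m (graph F)) \<mu>"
    and tight: "tight_seq (graph F) \<mu>"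
  shows "(\<exists>\<nu>. accumulation_point (narrow_topology (graph F)) \<mu> \<nu>) \<and>
    (\<forall>\<nu>. accumulation_point (narrow_topology (graph F)) \<mu> \<nu> \<longrightarrow>
       is_arg_min (\<lambda>\<nu>. f (integral\<^sup>L \<nu> g)) (\<lambda>\<nu>. \<nu> \<in> probs_with_marginal m (graph F)) \<nu>)"
proof (intro conjI allI impI)
  have \<mu>: "\<mu> n \<in> probs_with_marginal m (graph F)" for n
    using minimizing by (simp add: minimizing_sequence_def)
  then have \<mu>_probs: "\<mu> n \<in> borel_probs (graph F)" for n
    by (simp add: probs_with_marginal_def)
  show "\<exists>\<nu>. accumulation_point (narrow_topology (graph F)) \<mu> \<nu>"
    by (rule tight_seq_imp_convergent_subseq[OF \<mu>_probs tight]) (intro exI accumulation_point_subseq)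
  fix \<nu> assume acc: "accumulation_point (narrow_topology (graph F)) \<mu> \<nu>"
  then have \<nu>: "\<nu> \<in> borel_probs (graph F)"
    by (simp add: accumulation_point_def)
  have fst_meas: "fst \<in> borel_measurable (restrict_space borel (graph F))"
    by (intro borel_measurable_continuous_on_restrict continuous_on_fst continuous_on_id)

  \<comment> \<open>The marginal constraint at the accumulation point\<close>
  have "distr \<nu> borel fst = m"
  proof (rule borel_probs_eqI_bounded_continuous)
    have "fst \<in> borel_measurable \<nu>"
      using fst_meas by (simp add: borel_probs_imp_measurable_eq[OF \<nu>])
    then show "distr \<nu> borel fst \<in> borel_probs UNIV"
      using prob_space.prob_space_distr[OF borel_probs_imp_prob_space[OF \<nu>]]
      by (simp add: borel_probs_def)
    fix h :: "'a \<Rightarrow> real"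
    assume h: "continuous_on UNIV h" "bounded (range h)"
    have distr_fst: "integral\<^sup>L (distr \<kappa> borel fst) h = (\<integral>z. h (fst z) \<partial>\<kappa>)"
      if "\<kappa> \<in> borel_probs (graph F)" for \<kappa>
      using fst_meas borel_measurable_continuous_onI[OF h(1)]
      by (intro integral_distr) (simp_all add: borel_probs_imp_measurable_eq[OF that])
    have \<mu>_eq: "(\<integral>z. h (fst z) \<partial>\<mu> n) = integral\<^sup>L m h" for n
      using distr_fst[OF \<mu>_probs[of n]] \<mu>[of n] by (simp add: probs_with_marginal_def)
    have cont: "continuous_on (graph F) (\<lambda>z. h (fst z))"
      by (rule continuous_on_compose2[OF h(1) continuous_on_fst[OF continuous_on_id]]) simp
    have bdd: "bounded ((\<lambda>z. h (fst z)) ` graph F)"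
      by (rule bounded_subset[OF h(2)]) auto
    have "(\<integral>z. h (fst z) \<partial>\<nu>) = integral\<^sup>L m h"
    proof (rule ccontr)
      \<comment> \<open>The integral is the same for every \<open>\<mu> n\<close>; if
        \<open>\<nu>\<close> had another value, the open complement of the common value would have
        to be visited infinitely often.\<close>
      assume "\<not> ?thesis"
      then have "\<exists>\<^sub>F n in sequentially. (\<integral>z. h (fst z) \<partial>\<mu> n) \<in> - {integral\<^sup>L m h}"
        by (intro accumulation_point_frequently_integral[OF acc cont bdd]) auto
      then show False
        by (simp add: \<mu>_eq)
    qed
    then show "integral\<^sup>L (distr \<nu> borel fst) h = integral\<^sup>L m h"
      by (simp add: distr_fst[OF \<nu>])
  qed (rule m)
  then have \<nu>_marginal: "\<nu> \<in> probs_with_marginal m (graph F)"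
    using \<nu> by (simp add: probs_with_marginal_def)

  \<comment> \<open>Lower semicontinuity of the objective and minimality\<close>
  let ?J = "\<lambda>\<nu>. f (integral\<^sup>L \<nu> g)"
  let ?l = "gradient f (integral\<^sup>L \<nu> g)"
  have inner_integral: "integral\<^sup>L \<kappa> (\<lambda>z. inner ?l (g z)) = inner ?l (integral\<^sup>L \<kappa> g)"
    if "\<kappa> \<in> borel_probs (graph F)" for \<kappa>
    using integrable_borel_probs_bounded[OF that g_measurable g_bounded]
    by (rule integral_inner_right)
  have gl_bounded: "bounded ((\<lambda>z. inner ?l (g z)) ` graph F)"
    using bounded_linear_image[OF g_bounded bounded_linear_inner_right, of ?l]
    by (simp add: image_image)
  have gl_measurable: "(\<lambda>z. inner ?l (g z)) \<in> borel_measurable (restrict_space borel (graph F))"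
    by (intro borel_measurable_inner borel_measurable_const g_measurable)
  have J_lsc: "\<exists>\<^sub>F n in sequentially. c < ?J (\<mu> n)" if "c < ?J \<nu>" for c
  proof -
    \<comment> \<open>The tangent touches \<open>f\<close> at the mean of \<open>\<nu>\<close>, so
      the linear term may drop by the whole slack \<open>?J \<nu> - c\<close> before the tangent
      bound on \<open>?J (\<mu> n)\<close> falls to \<open>c\<close>.\<close>
    have "inner ?l (integral\<^sup>L \<nu> g) - (?J \<nu> - c) < integral\<^sup>L \<nu> (\<lambda>z. inner ?l (g z))"
      using that by (simp add: inner_integral[OF \<nu>])
    then have "\<exists>\<^sub>F n in sequentially.
        inner ?l (integral\<^sup>L \<nu> g) - (?J \<nu> - c) < integral\<^sup>L (\<mu> n) (\<lambda>z. inner ?l (g z))"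
      by (intro accumulation_point_frequently_integral_gt[OF acc \<mu>_probs]
          g_lsc rangeI gl_bounded gl_measurable)
    then show ?thesis
    proof (rule frequently_elim1)
      fix n
      assume "inner ?l (integral\<^sup>L \<nu> g) - (?J \<nu> - c) < integral\<^sup>L (\<mu> n) (\<lambda>z. inner ?l (g z))"
      moreover have "?J \<nu> + inner ?l (integral\<^sup>L (\<mu> n) g - integral\<^sup>L \<nu> g) \<le> ?J (\<mu> n)"
        by (rule convex_on_above_tangent_gderiv[OF f_convex GDERIV_gradient[OF f_differentiable]])
      ultimately show "c < ?J (\<mu> n)"
        by (simp add: inner_integral[OF \<mu>_probs] inner_diff_right)
    qed
  qed
  have "?J \<nu> \<le> ?J \<kappa>" if \<kappa>: "\<kappa> \<in> probs_with_marginal m (graph F)" for \<kappa>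
  proof (rule ccontr)
    assume "\<not> ?J \<nu> \<le> ?J \<kappa>"
    then obtain c where c: "?J \<kappa> < c" "c < ?J \<nu>"
      using dense[of "?J \<kappa>" "?J \<nu>"] by (auto simp: not_le)
    \<comment> \<open>The minimizing sequence is eventually below \<open>c\<close>, whereas
      \<open>J_lsc\<close> puts it above \<open>c\<close> infinitely often. In the extended reals
      this comparison also covers an infimum of minus infinity.\<close>
    have "(INF \<kappa>\<in>probs_with_marginal m (graph F). ereal (?J \<kappa>)) \<le> ereal (?J \<kappa>)"
      using \<kappa> by (rule INF_lower)
    also have "\<dots> < ereal c"
      using c(1) by simp
    finally have "\<forall>\<^sub>F n in sequentially. ereal (?J (\<mu> n)) < ereal c"
      by (rule order_tendstoD(2)[OF conjunct2[OF minimizing[unfolded minimizing_sequence_def]]])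
    then have "\<forall>\<^sub>F n in sequentially. \<not> c < ?J (\<mu> n)"
      by (rule eventually_mono) simp
    then show False
      using J_lsc[OF c(2)] by (simp add: frequently_def)
  qed
  then show "is_arg_min ?J (\<lambda>\<nu>. \<nu> \<in> probs_with_marginal m (graph F)) \<nu>"
    using \<nu>_marginal by (simp add: is_arg_min_linorder)
qed

end
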